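(* Let $\mathcal{S}$ be a set of $n$ Pauli operators on a common system of qubits. Then $\mathcal{S}$ is contextual if and only if it contains a subset consisting of four operators $\{A,B,C,D\}$ whose compatibility graph is, up to a permutation of the four operators, one of the following three graphs on the vertices $A,B,C,D$: (i) the graph with edge set $\{AB, AC\}$ (a path on three vertices together with the isolated vertex $D$); (ii) the graph with edge set $\{AB, AC, BD\}$ (a path on four vertices); (iii) the graph with edge set $\{AB, AC, BD, CD\}$ (a 4-cycle).
   Context: Pauli operators: fix a number of qubits $N\ge 1$. A Pauli operator is an operator $\pm\, P_1\otimes\cdots\otimes P_N$ with each $P_i\in\{I,X,Y,Z\}$ (the $2\times 2$ identity and the Pauli matrices). Any two Pauli operators either commute or anticommute, and each squares to the identity. Operators are compared including their sign, so $A$ and $-A$ are different operators. Determining tree: a determining tree for a Pauli operator $A$ over a set $\mathcal{S}$ of Pauli operators is a finite rooted tree whose nodes are (labelled by) Pauli operators, with repetitions allowed, and whose leaves are operators in $\mathcal{S}$, such that (1) the root is $A$; (2) all children of any particular parent pairwise commute as operators; (3) every parent node is the operator product of its children. (A single node $B\in\mathcal{S}$ is a determining tree for $B$.) Determining set: the determining set of a determining tree is the set containing one copy of each operator that occurs with odd multiplicity as a leaf of the tree. Contextual: a set $\mathcal{S}$ of Pauli operators is contextual if for some Pauli operator $A$ there exist a determining tree $\tau$ for $A$ over $\mathcal{S}$ and a determining tree $\tau'$ for $-A$ over $\mathcal{S}$ such that the determining sets of $\tau$ and $\tau'$ are identical. Otherwise it is noncontextual. Compatibility graph: the compatibility graph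 of a set $\mathcal{S}$ of Pauli operators is the undirected graph whose vertices are the operators in $\mathcal{S}$, with two distinct operators adjacent if and only if they commute. *)

theory Defs
  imports "HOL-Analysis.Analysis" "HOL-Library.Multiset"
begin

text \<open>
  The qubits are indexed by a finite type \<open>'n\<close>, so the number of qubits is
  \<open>N = CARD('n) \<ge> 1\<close>. The computational basis of the \<open>N\<close>-qubit space is indexed by
  the functions \<open>'n \<Rightarrow> 2\<close>, and an operator is its matrix in that basis (row index first).
\<close>

type_synonym 'n operator = "complex ^ ('n \<Rightarrow> 2) ^ ('n \<Rightarrow> 2)"

definition pauli_I :: "complex ^ 2 ^ 2" where
  "pauli_I = vector [vector [1, 0], vector [0, 1]]"

definition pauli_X :: "complex ^ 2 ^ 2" where
  "pauli_X = vector [vector [0, 1], vector [1, 0]]"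

definition pauli_Y :: "complex ^ 2 ^ 2" where
  "pauli_Y = vector [vector [0, - \<i>], vector [\<i>, 0]]"

definition pauli_Z :: "complex ^ 2 ^ 2" where
  "pauli_Z = vector [vector [1, 0], vector [0, - 1]]"

definition tensor :: "('n::finite \<Rightarrow> complex ^ 2 ^ 2) \<Rightarrow> 'n operator" where
  "tensor P = (\<chi> r c. \<Prod>i\<in>UNIV. P i $ r i $ c i)"

definition pauli_operators :: "'n::finite operator set" where
  "pauli_operators =
     {A. \<exists>P. (\<forall>i. P i \<in> {pauli_I, pauli_X, pauli_Y, pauli_Z}) \<and>
             (A = tensor P \<or> A = - tensor P)}"

definition commute :: "'n::finite operator \<Rightarrow> 'n operator \<Rightarrow> bool" where
  "commute A B \<longleftrightarrow> A ** B = B ** A"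

definition operator_product :: "'n::finite operator list \<Rightarrow> 'n operator" where
  "operator_product As = foldr (**) As (mat 1)"

text \<open>
  A finite rooted tree with labelled nodes; a leaf is a node without children. The children
  are listed in some order, which is immaterial for determining trees, since the labels of
  siblings commute there.
\<close>

datatype 'a rtree = Node (label: 'a) (children: "'a rtree list")

primrec leaves :: "'a rtree \<Rightarrow> 'a multiset" where
  "leaves (Node A ts) = (if ts = [] then {#A#} else sum_list (map leaves ts))"

primrec determining_tree_over :: "'n::finite operator set \<Rightarrow> 'n operator rtree \<Rightarrow> bool" where
  "determining_tree_over S (Node A ts) \<longleftrightarrow>
     A \<in> pauli_operators \<and>
     (if ts = [] then A \<in> S
      else (\<forall>t\<in>set ts. \<forall>u\<in>set ts. commute (label t) (label u)) \<and>
           A = operator_product (map label ts) \<and>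
           list_all (determining_tree_over S) ts)"

definition determining_tree ::
  "'n::finite operator \<Rightarrow> 'n operator set \<Rightarrow> 'n operator rtree \<Rightarrow> bool" where
  "determining_tree A S t \<longleftrightarrow> label t = A \<and> determining_tree_over S t"

definition determining_set :: "'a rtree \<Rightarrow> 'a set" where
  "determining_set t = {B. odd (count (leaves t) B)}"

definition contextual :: "'n::finite operator set \<Rightarrow> bool" where
  "contextual S \<longleftrightarrow>
     (\<exists>A\<in>pauli_operators. \<exists>t t'.
        determining_tree A S t \<and> determining_tree (- A) S t' \<and>
        determining_set t = determining_set t')"

text \<open>An undirected graph is given by its vertex set and its set of two-element edges.\<close>

definition compatibility_graph ::
  "'n::finite operator set \<Rightarrow> 'n operator set \<times> 'n operator set set" where
  "compatibility_graph S = (S, {{A, B} | A B. A \<in> S \<and> B \<in> S \<and> A \<noteq> B \<and> commute A B})"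

end

theory Submission
  imports Defs
begin

text \<open>
  Each of the three graphs yields two determining trees with opposite roots, found by multiplying
  commuting operators; for the 4-cycle the roots are \<open>(AB)(CD)\<close> and \<open>(AC)(BD) = -(AB)(CD)\<close>, a
  Mermin square.

  If none of the graphs occurs, commutation is an equivalence relation on the operators of \<open>S\<close> that
  do not commute with all of \<open>S\<close>. Fix a representative \<open>c\<close> of each class. The products \<open>c s\<close> with
  \<open>s\<close> in the class of \<open>c\<close>, together with the operators commuting with all of \<open>S\<close>, commute with all
  of \<open>S\<close> and hence have a joint eigenvector \<open>x\<close>. Every node of a determining tree is \<open>h\<close> or
  \<open>c h\<close> with \<open>h\<close> commuting with all of \<open>S\<close> and \<open>x\<close> an eigenvector of \<open>h\<close>; assigning
  to the node the eigenvalue of \<open>h\<close> is multiplicative along commuting products. So the determining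
  set fixes the value of the root, whereas \<open>A\<close> and \<open>-A\<close> would have opposite values.
\<close>

section \<open>Signs and scalars in matrix products\<close>

lemma matrix_mul_minus_left [simp]:
  fixes A :: "'a::ring_1 ^ 'n ^ 'm" and B :: "'a ^ 'p ^ 'n"
  shows "(- A) ** B = - (A ** B)"
  by (simp add: vec_eq_iff matrix_matrix_mult_def sum_negf)

lemma matrix_mul_minus_right [simp]:
  fixes A :: "'a::ring_1 ^ 'n ^ 'm" and B :: "'a ^ 'p ^ 'n"
  shows "A ** (- B) = - (A ** B)"
  by (simp add: vec_eq_iff matrix_matrix_mult_def sum_negf)

lemma matrix_vector_mul_minus_left [simp]:
  fixes A :: "'a::ring_1 ^ 'n ^ 'm"
  shows "(- A) *v x = - (A *v x)"
  by (simp add: vec_eq_iff matrix_vector_mult_def sum_negf)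

text \<open>It carries the phases that arise when Pauli matrices are multiplied.\<close>

definition mat_smult :: "complex \<Rightarrow> complex ^ 'n ^ 'm \<Rightarrow> complex ^ 'n ^ 'm" where
  "mat_smult a M = (\<chi> r. a *s M $ r)"

lemma mat_smult_mat_smult: "mat_smult a (mat_smult b M) = mat_smult (a * b) M"
  by (simp add: mat_smult_def vec_eq_iff mult.assoc)

section \<open>Pauli operators\<close>

text \<open>By distributivity, a product over qubits of sums over one bit is a sum over all basis
  states, which is the sum in the matrix product.\<close>

lemma tensor_mult: "tensor P ** tensor Q = tensor (\<lambda>i. P i ** Q i)"
proof -
  have "(\<Sum>k\<in>UNIV. (\<Prod>i\<in>UNIV. P i $ r i $ k i) * (\<Prod>i\<in>UNIV. Q i $ k i $ c i)) =
     (\<Prod>i\<in>UNIV. \<Sum>k\<in>UNIV. P i $ r i $ k * Q i $ k $ c i)" for r c :: "'a \<Rightarrow> 2"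
    by (subst prod_sum_PiE) (simp_all add: prod.distrib PiE_UNIV_domain)
  then show ?thesis
    by (simp add: tensor_def matrix_matrix_mult_def vec_eq_iff)
qed

lemma tensor_mat_smult:
  assumes "\<And>i. P i = mat_smult (a i) (Q i)"
  shows "tensor P = mat_smult (\<Prod>i\<in>UNIV. a i) (tensor Q)"
  using assms by (simp add: mat_smult_def tensor_def vec_eq_iff prod.distrib)

lemma tensor_mat_1: "tensor (\<lambda>i. mat 1) = mat 1"
  by (auto simp: tensor_def mat_def vec_eq_iff fun_eq_iff)

section \<open>Single-qubit Pauli matrices\<close>

abbreviation paulis :: "(complex ^ 2 ^ 2) set" where
  "paulis \<equiv> {pauli_I, pauli_X, pauli_Y, pauli_Z}"

lemmas pauli_defs = pauli_I_def pauli_X_def pauli_Y_def pauli_Z_def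

lemma pauli_square: "P \<in> paulis \<Longrightarrow> P ** P = mat 1"
  by (auto simp: pauli_defs matrix_matrix_mult_def vec_eq_iff forall_2 sum_2 mat_def)

lemma pauli_table:
  "pauli_I ** R = mat_smult 1 R" "R ** pauli_I = mat_smult 1 R"
  "pauli_X ** pauli_X = mat_smult 1 pauli_I"
  "pauli_Y ** pauli_Y = mat_smult 1 pauli_I"
  "pauli_Z ** pauli_Z = mat_smult 1 pauli_I"
  "pauli_X ** pauli_Y = mat_smult \<i> pauli_Z"
  "pauli_Y ** pauli_Z = mat_smult \<i> pauli_X"
  "pauli_Z ** pauli_X = mat_smult \<i> pauli_Y"
  "pauli_Y ** pauli_X = mat_smult (- \<i>) pauli_Z"
  "pauli_Z ** pauli_Y = mat_smult (- \<i>) pauli_X"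
  "pauli_X ** pauli_Z = mat_smult (- \<i>) pauli_Y"
  by (simp_all add: pauli_defs matrix_matrix_mult_def vec_eq_iff forall_2 sum_2 mat_smult_def)

text \<open>The phase is left unrestricted: for commuting operators,
  \<open>pauli_operators_mult\<close> finds the global sign from the square of the total
  phase.\<close>

lemma pauli_mult:
  assumes "P \<in> paulis" "Q \<in> paulis"
  shows "\<exists>a. \<exists>R\<in>paulis. P ** Q = mat_smult a R"
  using assms pauli_table
  by (elim insertE emptyE; simp only:; blast)

lemma pauli_commute_or_anticommute:
  assumes "P \<in> paulis" "Q \<in> paulis"
  shows "\<exists>b\<in>{1, - 1}. P ** Q = mat_smult b (Q ** P)"
  using assms
  by (elim insertE emptyE; simp add: pauli_table mat_smult_mat_smult)

section \<open>Pauli operators on several qubits\<close>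

lemma pauli_operators_cases:
  assumes "A \<in> pauli_operators"
  obtains P where "\<And>i. P i \<in> paulis" "A = tensor P \<or> A = - tensor P"
  using assms unfolding pauli_operators_def by blast

lemma pauli_operatorsI:
  "(\<And>i. P i \<in> paulis) \<Longrightarrow> A = tensor P \<or> A = - tensor P \<Longrightarrow> A \<in> pauli_operators"
  unfolding pauli_operators_def by blast

lemma pauli_operators_square: "A \<in> pauli_operators \<Longrightarrow> A ** A = mat 1"
  by (erule pauli_operators_cases) (auto simp: tensor_mult pauli_square tensor_mat_1)

definition anticommute :: "'n::finite operator \<Rightarrow> 'n operator \<Rightarrow> bool" where
  "anticommute A B \<longleftrightarrow> A ** B = - (B ** A)"

lemma mat_smult_pm1:
  fixes M :: "'n::finite operator"
  assumes "b \<in> {1, - 1}"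
  shows "mat_smult b M = M \<or> mat_smult b M = - M"
  using assms by (auto simp: mat_smult_def vec_eq_iff)

text \<open>Each qubit contributes a sign to the exchange, and the product of these signs is again a
  sign.\<close>

lemma pauli_operators_commute_or_anticommute:
  assumes "A \<in> pauli_operators" "B \<in> pauli_operators"
  shows "commute A B \<or> anticommute A B"
proof -
  obtain P where P: "\<And>i. P i \<in> paulis" "A = tensor P \<or> A = - tensor P"
    using assms(1) by (rule pauli_operators_cases) blast
  obtain Q where Q: "\<And>i. Q i \<in> paulis" "B = tensor Q \<or> B = - tensor Q"
    using assms(2) by (rule pauli_operators_cases) blast
  have "\<forall>i. \<exists>b\<in>{1, - 1}. P i ** Q i = mat_smult b (Q i ** P i)"
    using pauli_commute_or_anticommute P(1) Q(1) by blast
  then obtain b where b: "\<And>i. b i \<in> {1, - 1}"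
    "\<And>i. P i ** Q i = mat_smult (b i) (Q i ** P i)"
    by metis
  have prod: "(\<Prod>i\<in>F. b i) \<in> {1, - 1}" if "finite F" for F
    using that
  proof (induction F rule: finite_induct)
    case (insert x F)
    then show ?case using b(1)[of x] by auto
  qed simp
  have "tensor P ** tensor Q = mat_smult (\<Prod>i\<in>UNIV. b i) (tensor Q ** tensor P)"
    unfolding tensor_mult using b(2) by (rule tensor_mat_smult)
  then have "tensor P ** tensor Q = tensor Q ** tensor P \<or>
      tensor P ** tensor Q = - (tensor Q ** tensor P)"
    using mat_smult_pm1[OF prod[OF finite]] by metis
  then show ?thesis
    using P(2) Q(2) by (auto simp: commute_def anticommute_def)
qed

text \<open>The factors multiply to a phase \<open>p\<close> times a tensor product of Pauli
  matrices. As the two operators commute, their product squares to the identity, which forces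
  \<open>p\<close> to be a sign.\<close>

lemma pauli_operators_mult:
  fixes A B :: "'n::finite operator"
  assumes "A \<in> pauli_operators" "B \<in> pauli_operators" "commute A B"
  shows "A ** B \<in> pauli_operators"
proof -
  obtain P where P: "\<And>i. P i \<in> paulis" "A = tensor P \<or> A = - tensor P"
    using assms(1) by (rule pauli_operators_cases) blast
  obtain Q where Q: "\<And>i. Q i \<in> paulis" "B = tensor Q \<or> B = - tensor Q"
    using assms(2) by (rule pauli_operators_cases) blast
  have "\<forall>i. \<exists>a. \<exists>R\<in>paulis. P i ** Q i = mat_smult a R"
    using pauli_mult P(1) Q(1) by blast
  then obtain a R where R: "\<And>i. R i \<in> paulis"
    and a: "\<And>i. P i ** Q i = mat_smult (a i) (R i)"
    by metis
  define p where "p = (\<Prod>i\<in>UNIV. a i)"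
  have PQ: "tensor P ** tensor Q = mat_smult p (tensor R)"
    unfolding tensor_mult p_def using a by (rule tensor_mat_smult)
  have R2: "tensor R ** tensor R = mat 1"
    using R by (simp add: tensor_mult pauli_square tensor_mat_1)
  have P2: "tensor P ** tensor P = mat 1" and Q2: "tensor Q ** tensor Q = mat 1"
    using P(1) Q(1) by (simp_all add: tensor_mult pauli_square tensor_mat_1)
  have comm: "tensor P ** tensor Q = tensor Q ** tensor P"
    using assms(3) P(2) Q(2) by (auto simp: commute_def)
  have "(tensor P ** tensor Q) ** (tensor P ** tensor Q) =
      tensor P ** (tensor Q ** tensor Q) ** tensor P"
    by (metis comm matrix_mul_assoc)
  also have "\<dots> = mat 1" by (simp add: P2 Q2)
  finally have "mat_smult p (tensor R) ** mat_smult p (tensor R) = mat 1"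
    by (simp add: PQ)
  moreover have "mat_smult p (tensor R) ** mat_smult p (tensor R) =
      mat_smult (p\<^sup>2) (tensor R ** tensor R)"
    by (simp add: mat_smult_def matrix_matrix_mult_def vec_eq_iff sum_distrib_left power2_eq_square mult_ac)
  ultimately have "mat_smult (p\<^sup>2) (mat 1) = (mat 1 :: 'n operator)"
    by (simp add: R2)
  then have "p\<^sup>2 = 1"
    by (auto simp: mat_smult_def vec_eq_iff mat_def split: if_splits)
  then have "p \<in> {1, - 1}" by (simp add: power2_eq_1_iff)
  then have "tensor P ** tensor Q = tensor R \<or> tensor P ** tensor Q = - tensor R"
    unfolding PQ by (rule mat_smult_pm1)
  then have "A ** B = tensor R \<or> A ** B = - tensor R"
    using P(2) Q(2) by auto
  with R show ?thesis by (rule pauli_operatorsI)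
qed

section \<open>Commutation and anticommutation\<close>

lemma commute_sym: "commute A B \<Longrightarrow> commute B A"
  by (simp add: commute_def)

lemma commute_iff: "commute A B \<longleftrightarrow> commute B A"
  unfolding commute_def by (rule eq_commute)

lemma commute_refl: "commute A A"
  by (simp add: commute_def)

lemma commute_mult_left: "commute A C \<Longrightarrow> commute B C \<Longrightarrow> commute (A ** B) C"
  unfolding commute_def by (metis matrix_mul_assoc)

lemma commute_mult_right: "commute C A \<Longrightarrow> commute C B \<Longrightarrow> commute C (A ** B)"
  using commute_mult_left commute_sym by blast

lemma anticommute_sym: "anticommute A B \<Longrightarrow> anticommute B A"
  by (simp add: anticommute_def)

text \<open>Moving \<open>C\<close> past \<open>B\<close> and then past \<open>A\<close> changes the
  sign twice.\<close>

lemma anticommute_mult_left: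
  assumes "anticommute A C" "anticommute B C" shows "commute (A ** B) C"
proof -
  have "(A ** B) ** C = A ** (B ** C)" by (simp add: matrix_mul_assoc)
  also have "\<dots> = - ((A ** C) ** B)"
    using assms(2) by (simp add: anticommute_def matrix_mul_assoc)
  also have "\<dots> = C ** (A ** B)"
    using assms(1) by (simp add: anticommute_def matrix_mul_assoc)
  finally show ?thesis by (simp add: commute_def)
qed

section \<open>Derivability by determining trees\<close>

text \<open>The leaf multiset is recorded instead of the determining set, because multisets simply
  add when trees are joined; parities are compared only in \<open>contextualI\<close>.\<close>

definition derivable :: "'n::finite operator set \<Rightarrow> 'n operator \<Rightarrow> 'n operator multiset \<Rightarrow> bool"
  where "derivable S A M \<longleftrightarrow> (\<exists>t. determining_tree A S t \<and> leaves t = M)"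

lemma derivable_pauli: "derivable S A M \<Longrightarrow> A \<in> pauli_operators"
  unfolding derivable_def determining_tree_def
  by (metis determining_tree_over.simps rtree.exhaust rtree.sel(1))

lemma derivable_leaf: "A \<in> S \<Longrightarrow> A \<in> pauli_operators \<Longrightarrow> derivable S A {#A#}"
  unfolding derivable_def determining_tree_def by (intro exI[of _ "Node A []"]) simp

lemma derivable_mult:
  assumes "derivable S A M" "derivable S B M'" "commute A B"
  shows "derivable S (A ** B) (M + M')"
proof -
  obtain t u where "determining_tree A S t" "leaves t = M" "determining_tree B S u" "leaves u = M'"
    using assms unfolding derivable_def by blast
  moreover have "A ** B \<in> pauli_operators"
    using assms derivable_pauli pauli_operators_mult by blast
  ultimately show ?thesis
    using assms(3) unfolding derivable_def determining_tree_def
    by (intro exI[of _ "Node (A ** B) [t, u]"])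
      (auto simp: operator_product_def commute_sym commute_refl)
qed

lemma contextualI:
  assumes "derivable S A M" "derivable S (- A) M'" "\<And>B. odd (count M B) \<longleftrightarrow> odd (count M' B)"
  shows "contextual S"
  using assms derivable_pauli[OF assms(1)]
  unfolding contextual_def derivable_def determining_set_def by auto

section \<open>Contextual configurations of four operators\<close>

lemma commute_left_commute: "commute A B \<Longrightarrow> A ** (B ** X) = B ** (A ** X)"
  by (simp add: commute_def matrix_mul_assoc)

lemma anticommute_left_commute: "anticommute A B \<Longrightarrow> A ** (B ** X) = - (B ** (A ** X))"
  by (simp add: anticommute_def matrix_mul_assoc)

text \<open>Exchanging \<open>A ** B\<close> with \<open>C ** D\<close> meets two anticommuting
  pairs, so these products commute; likewise \<open>A ** C\<close> and \<open>B ** D\<close>.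
  Passing from \<open>ABCD\<close> to \<open>ACBD\<close> swaps one anticommuting pair, which makes
  the roots opposite.\<close>

lemma contextual_if_square:
  assumes S: "{A, B, C, D} \<subseteq> S" "S \<subseteq> pauli_operators"
    and AB: "commute A B" and AC: "commute A C" and BD: "commute B D" and CD: "commute C D"
    and AD: "anticommute A D" and BC: "anticommute B C"
  shows "contextual S"
proof -
  have leaf: "derivable S X {#X#}" if "X \<in> {A, B, C, D}" for X
    using that S by (auto intro!: derivable_leaf)
  \<comment> \<open>Every relation is oriented so that rewriting sorts the factors of a product
    alphabetically and collects the sign.\<close>
  note sort = AB[THEN commute_sym] AC[THEN commute_sym] BD[THEN commute_sym] CD[THEN commute_sym]
    AD[THEN anticommute_sym] BC[THEN anticommute_sym]
  note normalize = matrix_mul_assoc[symmetric]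
    sort(1-4)[unfolded commute_def] sort(1-4)[THEN commute_left_commute]
    sort(5-6)[unfolded anticommute_def] sort(5-6)[THEN anticommute_left_commute]
  have "commute (A ** B) (C ** D)" "commute (A ** C) (B ** D)"
    by (simp_all add: commute_def normalize)
  then have 1: "derivable S ((A ** B) ** (C ** D)) ({#A#} + {#B#} + ({#C#} + {#D#}))"
    and 2: "derivable S ((A ** C) ** (B ** D)) ({#A#} + {#C#} + ({#B#} + {#D#}))"
    by (intro derivable_mult leaf AB CD AC BD; simp)+
  have "(A ** C) ** (B ** D) = - ((A ** B) ** (C ** D))"
    by (simp add: normalize)
  with 2 have "derivable S (- ((A ** B) ** (C ** D))) ({#A#} + {#C#} + ({#B#} + {#D#}))"
    by simp
  with 1 show ?thesis
    by (rule contextualI) (simp add: ac_simps)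
qed

text \<open>The trees are \<open>((AC)D)(AB)\<close> and \<open>(BD)C\<close>. The leaf
  \<open>A\<close> occurs twice in the first and drops out of its determining set, so both sets
  consist of \<open>B\<close>, \<open>C\<close>, \<open>D\<close>.\<close>

lemma contextual_if_path:
  assumes S: "{A, B, C, D} \<subseteq> S" "S \<subseteq> pauli_operators"
    and AB: "commute A B" and AC: "commute A C" and BD: "commute B D" and CD: "anticommute C D"
    and AD: "anticommute A D" and BC: "anticommute B C"
  shows "contextual S"
proof -
  have leaf: "derivable S X {#X#}" if "X \<in> {A, B, C, D}" for X
    using that S by (auto intro!: derivable_leaf)
  have square: "A ** A = mat 1" "A ** (A ** X) = X" for X
    using S by (auto simp: pauli_operators_square matrix_mul_assoc)
  note sort = AB[THEN commute_sym] AC[THEN commute_sym] BD[THEN commute_sym]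
    CD[THEN anticommute_sym] AD[THEN anticommute_sym] BC[THEN anticommute_sym]
  note normalize = matrix_mul_assoc[symmetric] square
    sort(1-3)[unfolded commute_def] sort(1-3)[THEN commute_left_commute]
    sort(4-6)[unfolded anticommute_def] sort(4-6)[THEN anticommute_left_commute]
  have "commute (A ** C) D" "commute (A ** C ** D) (A ** B)" "commute (B ** D) C"
    by (simp_all add: commute_def normalize)
  then have 1: "derivable S ((A ** C ** D) ** (A ** B)) ({#A#} + {#C#} + {#D#} + ({#A#} + {#B#}))"
    and 2: "derivable S ((B ** D) ** C) ({#B#} + {#D#} + {#C#})"
    by (intro derivable_mult leaf AB AC BD; simp)+
  have "(B ** D) ** C = - ((A ** C ** D) ** (A ** B))"
    by (simp add: normalize)
  with 2 have "derivable S (- ((A ** C ** D) ** (A ** B))) ({#B#} + {#D#} + {#C#})"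
    by simp
  with 1 show ?thesis
    by (rule contextualI) auto
qed

text \<open>The trees are \<open>((AB)D)C\<close> and \<open>((AC)D)B\<close>. Here
  \<open>B\<close>, \<open>C\<close>, \<open>D\<close> pairwise anticommute, so reversing
  \<open>BDC\<close> to \<open>CDB\<close> costs three signs.\<close>

lemma contextual_if_path_and_point:
  assumes S: "{A, B, C, D} \<subseteq> S" "S \<subseteq> pauli_operators"
    and AB: "commute A B" and AC: "commute A C" and BD: "anticommute B D"
    and CD: "anticommute C D" and AD: "anticommute A D" and BC: "anticommute B C"
  shows "contextual S"
proof -
  have leaf: "derivable S X {#X#}" if "X \<in> {A, B, C, D}" for X
    using that S by (auto intro!: derivable_leaf)
  note sort = AB[THEN commute_sym] AC[THEN commute_sym] BD[THEN anticommute_sym]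
    CD[THEN anticommute_sym] AD[THEN anticommute_sym] BC[THEN anticommute_sym]
  note normalize = matrix_mul_assoc[symmetric]
    sort(1-2)[unfolded commute_def] sort(1-2)[THEN commute_left_commute]
    sort(3-6)[unfolded anticommute_def] sort(3-6)[THEN anticommute_left_commute]
  have "commute (A ** B) D" "commute (A ** B ** D) C" "commute (A ** C) D" "commute (A ** C ** D) B"
    by (simp_all add: commute_def normalize)
  then have 1: "derivable S (A ** B ** D ** C) ({#A#} + {#B#} + {#D#} + {#C#})"
    and 2: "derivable S (A ** C ** D ** B) ({#A#} + {#C#} + {#D#} + {#B#})"
    by (intro derivable_mult leaf AB AC; simp)+
  have "A ** C ** D ** B = - (A ** B ** D ** C)"
    by (simp add: normalize)
  with 2 have "derivable S (- (A ** B ** D ** C)) ({#A#} + {#C#} + {#D#} + {#B#})"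
    by simp
  with 1 show ?thesis
    by (rule contextualI) (simp add: ac_simps)
qed

text \<open>The pairs \<open>B\<close>, \<open>D\<close> and \<open>C\<close>, \<open>D\<close> are
  left open. Their four cases are the three graphs, the path on four vertices occurring
  twice.\<close>

lemma contextual_if_not_transitive:
  assumes S: "{A, B, C, D} \<subseteq> S" "S \<subseteq> pauli_operators"
    and AB: "commute A B" and AC: "commute A C" and AD: "\<not> commute A D"
    and BC: "\<not> commute B C"
  shows "contextual S"
proof -
  have pauli: "X \<in> pauli_operators" if "X \<in> {A, B, C, D}" for X
    using that S by blast
  have anti: "anticommute X Y" if "\<not> commute X Y" "X \<in> {A, B, C, D}" "Y \<in> {A, B, C, D}" for X Y
    using pauli_operators_commute_or_anticommute[OF pauli[OF that(2)] pauli[OF that(3)]] that(1)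
    by simp
  have AD': "anticommute A D" and BC': "anticommute B C"
    using AD BC by (auto intro: anti)
  consider "commute B D" "commute C D" | "commute B D" "\<not> commute C D"
    | "\<not> commute B D" "commute C D" | "\<not> commute B D" "\<not> commute C D" by blast
  then show ?thesis
  proof cases
    case 1
    then show ?thesis
      using contextual_if_square[OF S AB AC _ _ AD' BC'] by blast
  next
    case 2
    then have "anticommute C D" by (auto intro: anti)
    with 2 show ?thesis
      using contextual_if_path[OF S AB AC _ _ AD' BC'] by blast
  next
    case 3
    then have "anticommute B D" by (auto intro: anti)
    \<comment> \<open>This is the path with \<open>B\<close> and \<open>C\<close>
      interchanged.\<close>
    moreover have "{A, C, B, D} \<subseteq> S" using S by blast
    ultimately show ?thesis
      using contextual_if_path[OF _ S(2) AC AB 3(2) _ AD' anticommute_sym[OF BC']] by blast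
  next
    case 4
    then have "anticommute B D" "anticommute C D" by (auto intro: anti)
    then show ?thesis
      using contextual_if_path_and_point[OF S AB AC _ _ AD' BC'] by blast
  qed
qed

section \<open>Value assignments\<close>

text \<open>For a new involution \<open>B\<close>, the vector \<open>x + B *v x\<close> is fixed by
  \<open>B\<close>. If it vanishes, \<open>x\<close> itself has eigenvalue -1; otherwise it keeps
  the eigenvalues of \<open>x\<close> under the operators commuting with \<open>B\<close>.\<close>

lemma joint_eigenvector:
  fixes G :: "'n::finite operator set"
  assumes "finite G" "\<And>A. A \<in> G \<Longrightarrow> A ** A = mat 1"
    "\<And>A B. A \<in> G \<Longrightarrow> B \<in> G \<Longrightarrow> commute A B"
  shows "\<exists>x. x \<noteq> 0 \<and> (\<forall>A\<in>G. \<exists>e\<in>{1, - 1}. A *v x = e *s x)"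
  using assms
proof (induction G rule: finite_induct)
  case empty
  show ?case by (intro exI[of _ 1]) simp
next
  case (insert B G)
  have "\<exists>x. x \<noteq> 0 \<and> (\<forall>A\<in>G. \<exists>e\<in>{1, - 1}. A *v x = e *s x)"
    by (rule insert.IH) (simp_all add: insert.prems)
  then obtain x where x: "x \<noteq> 0" "\<And>A. A \<in> G \<Longrightarrow> \<exists>e\<in>{1, - 1}. A *v x = e *s x"
    by blast
  show ?case
  proof (cases "x + B *v x = 0")
    case True
    then have "B *v x = (- 1) *s x"
      by (simp add: vec_eq_iff eq_neg_iff_add_eq_0 add.commute)
    with x show ?thesis by blast
  next
    case False
    have "B *v (x + B *v x) = 1 *s (x + B *v x)"
      using insert.prems(1)[of B]
      by (simp add: matrix_vector_right_distrib matrix_vector_mul_assoc add.commute)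
    moreover have "\<exists>e\<in>{1, - 1}. A *v (x + B *v x) = e *s (x + B *v x)" if A: "A \<in> G" for A
    proof -
      obtain e where e: "e \<in> {1, - 1}" "A *v x = e *s x" using x(2) A by blast
      have "A *v (B *v x) = B *v (A *v x)"
        using insert.prems(2)[of A B] A by (simp add: commute_def matrix_vector_mul_assoc)
      then have "A *v (x + B *v x) = e *s (x + B *v x)"
        by (simp add: matrix_vector_right_distrib e vector_scalar_commute vector_add_ldistrib)
      with e(1) show ?thesis by blast
    qed
    ultimately show ?thesis using False by blast
  qed
qed

lemma prod_mset_leaves:
  "prod_mset (image_mset w (sum_list (map leaves ts))) =
     prod_list (map (\<lambda>t. prod_mset (image_mset w (leaves t))) ts)"
  by (induction ts) simp_all

lemma leaves_subset: "determining_tree_over S t \<Longrightarrow> set_mset (leaves t) \<subseteq> S"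
proof (induction t)
  case (Node A ts)
  have "set_mset (sum_list (map leaves us)) \<subseteq> S" if "\<And>t. t \<in> set us \<Longrightarrow> set_mset (leaves t) \<subseteq> S"
    for us :: "'a operator rtree list"
    using that by (induction us) auto
  with Node show ?case by (auto simp: list_all_iff split: if_splits)
qed

text \<open>Even powers of a sign are 1, so the product of signs over the leaves of a tree depends
  only on its determining set.\<close>

lemma prod_mset_signs:
  fixes w :: "'a \<Rightarrow> complex"
  assumes "\<And>x. x \<in># M \<Longrightarrow> w x \<in> {1, - 1}"
  shows "prod_mset (image_mset w M) = (\<Prod>x | odd (count M x). w x)"
proof -
  have "prod_mset (image_mset w M) = (\<Prod>x\<in>set_mset M. w x ^ count M x)"
    by (rule image_prod_mset_multiplicity)
  also have "\<dots> = (\<Prod>x\<in>set_mset M. if odd (count M x) then w x else 1)"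
  proof (rule prod.cong)
    fix x assume "x \<in># M"
    then show "w x ^ count M x = (if odd (count M x) then w x else 1)"
      using assms[of x] by auto
  qed simp
  also have "\<dots> = (\<Prod>x\<in>{x \<in> set_mset M. odd (count M x)}. w x)"
    by (rule prod.inter_filter[symmetric]) simp
  also have "{x \<in> set_mset M. odd (count M x)} = {x. odd (count M x)}"
    by (auto simp: not_in_iff[symmetric] dest: odd_pos)
  finally show ?thesis .
qed

lemma commute_operator_product:
  assumes "\<And>B. B \<in> set Bs \<Longrightarrow> commute A B"
  shows "commute A (operator_product Bs)"
  using assms
proof (induction Bs)
  case Nil
  show ?case by (simp add: operator_product_def commute_def)
next
  case (Cons B Bs)
  then have "commute A (B ** operator_product Bs)" by (intro commute_mult_right) simp_all
  then show ?case by (simp add: operator_product_def)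
qed

text \<open>In \<open>trans\<close> the operator \<open>D\<close> witnesses that \<open>A\<close> is
  not central; the hypothesis is transitivity of commutation through noncentral operators.\<close>

lemma not_contextual_if_transitive:
  fixes S :: "'n::finite operator set"
  assumes S: "S \<subseteq> pauli_operators" and fin: "finite S"
    and trans: "\<And>A B C D. A \<in> S \<Longrightarrow> B \<in> S \<Longrightarrow> C \<in> S \<Longrightarrow> D \<in> S \<Longrightarrow>
      commute A B \<Longrightarrow> commute A C \<Longrightarrow> \<not> commute A D \<Longrightarrow> commute B C"
  shows "\<not> contextual S"
proof -
  define central where "central A \<longleftrightarrow> (\<forall>s\<in>S. commute A s)" for A :: "'n operator"
  define T where "T = {s \<in> S. \<not> central s}"
  \<comment> \<open>The choice predicate depends only on the class of \<open>s\<close>, so commuting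
    members of \<open>T\<close> get literally the same representative.\<close>
  define rep where "rep s = (SOME t. t \<in> T \<and> commute s t)" for s
  have square: "s ** s = mat 1" "s ** (s ** X) = X" if "s \<in> S" for s X :: "'n operator"
    using that S by (auto simp: pauli_operators_square matrix_mul_assoc)
  have TS: "T \<subseteq> S" by (simp add: T_def)
  have T_trans: "commute s t" if "u \<in> T" "s \<in> S" "t \<in> S" "commute u s" "commute u t" for u s t
    using that trans[of u s t] by (auto simp: T_def central_def)
  have rep: "rep s \<in> T" "commute s (rep s)" if "s \<in> T" for s
    using someI[of "\<lambda>t. t \<in> T \<and> commute s t" s] that commute_refl unfolding rep_def by blast+
  have rep_eq: "rep s = rep t" if "s \<in> T" "t \<in> T" "commute s t" for s t
  proof -
    have "commute s u \<longleftrightarrow> commute t u" if "u \<in> T" for u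
      using T_trans[of s t u] T_trans[of t s u] \<open>s \<in> T\<close> \<open>t \<in> T\<close> \<open>commute s t\<close> that TS
        commute_sym[OF \<open>commute s t\<close>] by blast
    then show ?thesis unfolding rep_def by metis
  qed
  have rep_anticommute: "anticommute c d" if "c \<in> rep ` T" "d \<in> rep ` T" "c \<noteq> d" for c d
  proof -
    from that obtain s t where st: "s \<in> T" "t \<in> T" "c = rep s" "d = rep t" by blast
    have "\<not> commute c d"
    proof
      assume "commute c d"
      then have "commute s d"
        using T_trans[of c s d] rep st TS commute_sym by blast
      then have "commute s t"
        using T_trans[of d s t] rep st TS commute_sym by blast
      then show False using rep_eq st that by blast
    qed
    moreover have "c \<in> pauli_operators" "d \<in> pauli_operators"
      using st rep TS S by blast+
    ultimately show ?thesis using pauli_operators_commute_or_anticommute by blast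
  qed
  define gen where "gen s = (if s \<in> T then rep s ** s else s)" for s
  have central_gen: "central (gen s)" if "s \<in> S" for s
  proof (cases "s \<in> T")
    case True
    have "commute (rep s ** s) t" if t: "t \<in> S" for t
    proof (cases "commute s t")
      case c: True
      then show ?thesis
        using T_trans[of s "rep s" t] rep[OF True] True t TS by (blast intro: commute_mult_left)
    next
      \<comment> \<open>By transitivity through \<open>rep s\<close>, an operator failing to commute
        with \<open>s\<close> also fails to commute with \<open>rep s\<close>; the two signs
        cancel.\<close>
      case False
      then have "\<not> commute (rep s) t"
        using T_trans[of "rep s" s t] rep[OF True] True t TS commute_sym by blast
      moreover have "s \<in> pauli_operators" "rep s \<in> pauli_operators" "t \<in> pauli_operators"
        using True rep[OF True] t TS S by blast+
      ultimately show ?thesis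
        using False pauli_operators_commute_or_anticommute anticommute_mult_left by blast
    qed
    with True show ?thesis by (simp add: central_def gen_def)
  next
    case False
    with that show ?thesis by (simp add: gen_def T_def)
  qed
  have "gen s ** gen s = mat 1" if "s \<in> S" for s
  proof (cases "s \<in> T")
    case True
    have "rep s ** s ** (rep s ** s) = rep s ** (rep s ** (s ** s))"
      using commute_left_commute[OF rep(2)[OF True], of s] by (simp flip: matrix_mul_assoc)
    also have "\<dots> = mat 1" using square that rep(1)[OF True] TS by auto
    finally show ?thesis using True by (simp add: gen_def)
  qed (simp add: gen_def square that)
  moreover have "commute (gen s) (gen t)" if "s \<in> S" "t \<in> S" for s t
  proof -
    have "commute (gen s) t" "t \<in> T \<Longrightarrow> commute (gen s) (rep t)"
      using central_gen[OF that(1)] that(2) rep(1)[of t] TS unfolding central_def by blast+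
    then show ?thesis by (auto simp: gen_def[of t] intro: commute_mult_right)
  qed
  ultimately have "\<exists>x. x \<noteq> 0 \<and> (\<forall>A\<in>gen ` S. \<exists>e\<in>{1, - 1}. A *v x = e *s x)"
    using fin by (intro joint_eigenvector) auto
  then obtain x where x: "x \<noteq> 0"
    and eigen: "\<And>s. s \<in> S \<Longrightarrow> \<exists>e\<in>{1, - 1}. gen s *v x = e *s x"
    by blast

  define H where "H A e \<longleftrightarrow> central A \<and> e \<in> {1, - 1} \<and> A *v x = e *s x"
    for A :: "'n operator" and e
  \<comment> \<open>Since \<open>c ** c = mat 1\<close>, the second alternative says that
    \<open>A\<close> is \<open>c\<close> times the central operator \<open>c ** A\<close>. A
    relation is used, so the decomposition need not be shown unique.\<close>
  define val where "val A e \<longleftrightarrow> H A e \<or> (\<exists>c\<in>rep ` T. H (c ** A) e)" for A e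
  have H_eigen: "(A ** B) *v x = (a * b) *s x" if "H A a" "H B b" for A B a b
  proof -
    have "(A ** B) *v x = A *v (B *v x)" by (simp add: matrix_vector_mul_assoc)
    also have "\<dots> = (a * b) *s x"
      using that by (simp add: H_def vector_scalar_commute vector_smult_assoc mult.commute)
    finally show ?thesis .
  qed
  have H_mult: "H (A ** B) (a * b)" if "H A a" "H B b" for A B a b
    using that H_eigen[OF that] by (auto simp: H_def central_def intro: commute_mult_left)
  have H_rep: "commute A c" if "H A a" "c \<in> rep ` T" for A a c
    using that rep(1) TS by (auto simp: H_def central_def)
  have rep_square: "c ** c = mat 1" "c ** (c ** X) = X" if "c \<in> rep ` T" for c X :: "'n operator"
  proof -
    have "c \<in> S" using that rep(1) TS by blast
    then show "c ** c = mat 1" "c ** (c ** X) = X" by (rule square)+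
  qed
  have val_mult: "val (A ** B) (a * b)" if comm: "commute A B" and A: "val A a" and B: "val B b"
    for A B a b
  proof -
    consider "H A a" "H B b" | c where "c \<in> rep ` T" "H (c ** A) a" "H B b"
      | c where "c \<in> rep ` T" "H A a" "H (c ** B) b"
      | c d where "c \<in> rep ` T" "d \<in> rep ` T" "H (c ** A) a" "H (d ** B) b"
      using A B unfolding val_def by blast
    then show ?thesis
    proof cases
      case 1
      then show ?thesis using H_mult unfolding val_def by blast
    next
      case 2
      then have "H (c ** (A ** B)) (a * b)"
        using H_mult[of "c ** A" a B b] by (simp add: matrix_mul_assoc)
      with 2 show ?thesis unfolding val_def by blast
    next
      case 3
      have "c ** (A ** B) = A ** (c ** B)"
        by (rule commute_left_commute[OF H_rep[OF 3(2,1)], symmetric])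
      with H_mult[OF 3(2,3)] have "H (c ** (A ** B)) (a * b)" by simp
      with 3(1) show ?thesis unfolding val_def by blast
    next
      case 4
      show ?thesis
      proof (cases "c = d")
        case True
        \<comment> \<open>The two copies of \<open>c\<close> cancel, leaving a central
          product.\<close>
        have "c ** A ** (c ** B) = c ** (c ** A ** B)"
          by (rule commute_left_commute[OF H_rep[OF 4(3,1)]])
        also have "\<dots> = A ** B"
          using rep_square(2)[OF 4(1)] by (simp flip: matrix_mul_assoc)
        finally show ?thesis
          using H_mult[OF 4(3,4)] True unfolding val_def by simp
      next
        case False
        \<comment> \<open>This case is impossible: \<open>A\<close> and \<open>B\<close> commute
          while \<open>c\<close> and \<open>d\<close> anticommute, so \<open>h\<close> and
          \<open>k\<close> would anticommute, although \<open>x\<close> is a joint eigenvector with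
          nonzero eigenvalues.\<close>
        define h k where "h = c ** A" and "k = d ** B"
        have A_eq: "A = c ** h" and B_eq: "B = d ** k"
          using rep_square(2)[OF 4(1)] rep_square(2)[OF 4(2)] by (simp_all add: h_def k_def)
        have hd: "commute h d" and kc: "commute k c"
          using 4 H_rep h_def k_def by blast+
        have cd: "anticommute c d" using rep_anticommute 4(1,2) False by blast
        have "c ** (d ** (h ** k)) = A ** B"
          using commute_left_commute[OF hd, of k] by (simp add: A_eq B_eq flip: matrix_mul_assoc)
        also have "\<dots> = B ** A" using comm by (simp add: commute_def)
        also have "\<dots> = d ** (c ** (k ** h))"
          using commute_left_commute[OF kc, of h] by (simp add: A_eq B_eq flip: matrix_mul_assoc)
        also have "\<dots> = - (c ** (d ** (k ** h)))"
          by (rule anticommute_left_commute[OF anticommute_sym[OF cd]])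
        finally have "d ** (c ** (c ** (d ** (h ** k)))) = d ** (c ** (- (c ** (d ** (k ** h)))))"
          by simp
        then have "h ** k = - (k ** h)"
          using rep_square(2)[OF 4(1)] rep_square(2)[OF 4(2)] by simp
        then have "(h ** k) *v x = - ((k ** h) *v x)" by simp
        moreover have "(h ** k) *v x = (a * b) *s x" "(k ** h) *v x = (b * a) *s x"
          using 4(3,4) H_eigen unfolding h_def k_def by blast+
        ultimately have "(a * b) *s x = - ((a * b) *s x)"
          by (simp add: mult.commute)
        moreover have "a * b \<noteq> 0" using 4(3,4) by (auto simp: H_def)
        ultimately have "x = 0" by (simp add: vec_eq_iff)
        with x show ?thesis by blast
      qed
    qed
  qed
  have val_1: "val (mat 1) 1" by (simp add: val_def H_def central_def commute_def)
  have "\<forall>s\<in>S. \<exists>e. e \<in> {1, - 1} \<and> val s e"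
  proof
    fix s assume s: "s \<in> S"
    then obtain e where "e \<in> {1, - 1}" "gen s *v x = e *s x" using eigen by blast
    then have "H (gen s) e" "e \<in> {1, - 1}" using central_gen[OF s] by (simp_all add: H_def)
    then show "\<exists>e. e \<in> {1, - 1} \<and> val s e"
      unfolding val_def gen_def by (cases "s \<in> T") auto
  qed
  then obtain w where w: "\<And>s. s \<in> S \<Longrightarrow> w s \<in> {1, - 1}" "\<And>s. s \<in> S \<Longrightarrow> val s (w s)"
    by metis
  \<comment> \<open>\<open>W t\<close> will be a value of the root by \<open>val_tree\<close> and a
    function of the determining set by \<open>W_det\<close>.\<close>
  define W where "W t = prod_mset (image_mset w (leaves t))" for t
  have val_list: "val (operator_product (map label ts)) (prod_list (map W ts))"
    if "\<And>t. t \<in> set ts \<Longrightarrow> val (label t) (W t)"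
      "\<And>t u. t \<in> set ts \<Longrightarrow> u \<in> set ts \<Longrightarrow> commute (label t) (label u)" for ts
    using that
  proof (induction ts)
    case Nil
    show ?case using val_1 by (simp add: operator_product_def)
  next
    case (Cons t ts)
    have "commute (label t) (operator_product (map label ts))"
      using Cons.prems(2) by (intro commute_operator_product) auto
    moreover have "val (operator_product (map label ts)) (prod_list (map W ts))"
      using Cons.prems by (intro Cons.IH) auto
    ultimately have "val (label t ** operator_product (map label ts)) (W t * prod_list (map W ts))"
      using Cons.prems(1)[of t] by (intro val_mult) auto
    then show ?case by (simp add: operator_product_def)
  qed
  have val_tree: "determining_tree_over S t \<Longrightarrow> val (label t) (W t)" for t
  proof (induction t)
    case (Node A ts)
    show ?case
    proof (cases "ts = []")
      case True
      then show ?thesis using Node.prems w by (simp add: W_def)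
    next
      case False
      have "val (operator_product (map label ts)) (prod_list (map W ts))"
        using False Node by (intro val_list) (auto simp: list_all_iff)
      moreover have "W (Node A ts) = prod_list (map W ts)"
        using False unfolding W_def by (simp add: prod_mset_leaves)
      ultimately show ?thesis using False Node.prems by simp
    qed
  qed
  have W_det: "W t = prod w (determining_set t)" if "determining_tree_over S t" for t
    unfolding W_def determining_set_def
    using leaves_subset[OF that] w(1) by (intro prod_mset_signs) blast
  show ?thesis
  proof
    assume "contextual S"
    then obtain A t u where A: "A \<in> pauli_operators" and t: "determining_tree A S t"
      and u: "determining_tree (- A) S u" and tu: "determining_set t = determining_set u"
      unfolding contextual_def by blast
    have "val A (W t)" "val (- A) (W u)"
      using val_tree[of t] val_tree[of u] t u by (simp_all add: determining_tree_def)
    moreover have "W u = W t"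
      using W_det[of t] W_det[of u] t u tu by (simp add: determining_tree_def)
    moreover have "commute A (- A)" by (simp add: commute_def)
    \<comment> \<open>As \<open>val\<close> is only a relation, the contradiction is sought at
      \<open>A ** (- A) = - mat 1\<close>, which receives the value 1.\<close>
    ultimately have "val (A ** (- A)) (W t * W t)"
      using val_mult by metis
    moreover have "W t \<in> {1, - 1}"
      using \<open>val A (W t)\<close> unfolding val_def H_def by blast
    ultimately have "val (- mat 1) 1"
      using pauli_operators_square[OF A] by auto
    \<comment> \<open>Either \<open>x\<close> equals its own negative, or a representative in
      \<open>T\<close> is central.\<close>
    then consider "H (- mat 1) 1" | c where "c \<in> rep ` T" "H (- c) 1"
      unfolding val_def by auto
    then show False
    proof cases
      case 1
      then show False using x by (simp add: H_def vec_eq_iff)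
    next
      case 2
      then have "central c" "c \<in> T" using rep(1) by (auto simp: H_def central_def commute_def)
      then show False by (simp add: T_def)
    qed
  qed
qed

section \<open>Compatibility graphs and the characterization\<close>

lemma compatibility_graph_eq_iff:
  assumes "A \<in> T" "B \<in> T" "A \<noteq> B" "compatibility_graph T = (V, E)"
  shows "commute A B \<longleftrightarrow> {A, B} \<in> E"
proof -
  have "E = {{A, B} | A B. A \<in> T \<and> B \<in> T \<and> A \<noteq> B \<and> commute A B}"
    using arg_cong[OF assms(4), of snd] by (simp add: compatibility_graph_def)
  then show ?thesis
    using assms(1-3) commute_sym by (auto simp: doubleton_eq_iff)
qed

text \<open>The first condition keeps \<open>E\<close> free of anything but pairs of distinct
  vertices; the second then decides each pair.\<close>

lemma compatibility_graph_eqI: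
  assumes "\<And>e. e \<in> E \<Longrightarrow> \<exists>A\<in>T. \<exists>B\<in>T. e = {A, B} \<and> A \<noteq> B"
    and "\<And>A B. A \<in> T \<Longrightarrow> B \<in> T \<Longrightarrow> A \<noteq> B \<Longrightarrow> commute A B \<longleftrightarrow> {A, B} \<in> E"
  shows "compatibility_graph T = (T, E)"
  unfolding compatibility_graph_def using assms by fastforce

theorem theorem2:
  fixes S :: "'n::finite operator set" and n :: nat
  assumes "S \<subseteq> pauli_operators" and "finite S" and "card S = n"
  shows "contextual S \<longleftrightarrow>
    (\<exists>T A B C D. T \<subseteq> S \<and> card T = 4 \<and> T = {A, B, C, D} \<and>
       (compatibility_graph T = ({A, B, C, D}, {{A, B}, {A, C}}) \<or>
        compatibility_graph T = ({A, B, C, D}, {{A, B}, {A, C}, {B, D}}) \<or>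
        compatibility_graph T = ({A, B, C, D}, {{A, B}, {A, C}, {B, D}, {C, D}})))"
    (is "_ \<longleftrightarrow> (\<exists>T A B C D. ?Q T A B C D)")
proof
  assume "contextual S"
  have "\<exists>A B C D. {A, B, C, D} \<subseteq> S \<and> commute A B \<and> commute A C \<and>
    \<not> commute A D \<and> \<not> commute B C"
  proof (rule ccontr)
    assume neg: "\<not> ?thesis"
    have "\<not> contextual S"
      by (rule not_contextual_if_transitive[OF assms(1,2)]) (use neg in blast)
    with \<open>contextual S\<close> show False by blast
  qed
  then obtain A B C D where S: "{A, B, C, D} \<subseteq> S"
    and com: "commute A B" "commute A C" "\<not> commute A D" "\<not> commute B C"
    by blast
  \<comment> \<open>Any two of the four differ in their commutation with one of them.\<close>
  have neq: "A \<noteq> B" "A \<noteq> C" "A \<noteq> D" "B \<noteq> C" "B \<noteq> D" "C \<noteq> D"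
    using com commute_sym commute_refl by metis+
  then have card: "card {A, B, C, D} = 4" by simp
  have com': "commute B A" "commute C A" "\<not> commute D A" "\<not> commute C B"
    "commute D B \<longleftrightarrow> commute B D" "commute D C \<longleftrightarrow> commute C D"
    using com by (simp_all only: commute_iff[of B A] commute_iff[of C A] commute_iff[of D A]
        commute_iff[of C B] commute_iff[of D B] commute_iff[of D C] not_False_eq_True)
  define E where "E = {{A, B}, {A, C}} \<union> (if commute B D then {{B, D}} else {}) \<union>
    (if commute C D then {{C, D}} else {})"
  have graph: "compatibility_graph {A, B, C, D} = ({A, B, C, D}, E)"
  proof (rule compatibility_graph_eqI)
    fix e assume "e \<in> E"
    then consider "e = {A, B}" | "e = {A, C}" | "e = {B, D}" | "e = {C, D}"
      unfolding E_def by (auto split: if_splits)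
    then show "\<exists>X\<in>{A, B, C, D}. \<exists>Y\<in>{A, B, C, D}. e = {X, Y} \<and> X \<noteq> Y"
      by cases (use neq in blast)+
  next
    fix X Y assume "X \<in> {A, B, C, D}" "Y \<in> {A, B, C, D}" "X \<noteq> Y"
    then show "commute X Y \<longleftrightarrow> {X, Y} \<in> E"
      using com com' neq neq[symmetric] unfolding E_def
      by (elim insertE emptyE; simp add: doubleton_eq_iff)
  qed
  \<comment> \<open>If \<open>CD\<close> is an edge and \<open>BD\<close> is not, the graph is a
    path after interchanging \<open>B\<close> and \<open>C\<close>.\<close>
  have vertices: "{A, B, C, D} = {A, C, B, D}" by blast
  consider "E = {{A, B}, {A, C}}" | "E = {{A, B}, {A, C}, {B, D}}"
    | "E = {{A, C}, {A, B}, {C, D}}" | "E = {{A, B}, {A, C}, {B, D}, {C, D}}"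
    unfolding E_def by (cases "commute B D"; cases "commute C D") (simp_all add: insert_commute)
  then have "?Q {A, B, C, D} A B C D \<or> ?Q {A, B, C, D} A C B D"
  proof cases
    case 1
    then show ?thesis using S card graph by blast
  next
    case 2
    then show ?thesis using S card graph by blast
  next
    case 3
    then have "compatibility_graph {A, B, C, D} = ({A, C, B, D}, {{A, C}, {A, B}, {C, D}})"
      using graph vertices by (simp only:)
    then show ?thesis using S card vertices by blast
  next
    case 4
    then show ?thesis using S card graph by blast
  qed
  then show "\<exists>T A B C D. ?Q T A B C D"
  proof
    assume "?Q {A, B, C, D} A B C D"
    then show ?thesis
      by - (rule exI[of _ "{A, B, C, D}"], rule exI[of _ A], rule exI[of _ B], rule exI[of _ C],
        rule exI[of _ D])
  next
    assume "?Q {A, B, C, D} A C B D"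
    then show ?thesis
      by - (rule exI[of _ "{A, B, C, D}"], rule exI[of _ A], rule exI[of _ C], rule exI[of _ B],
        rule exI[of _ D])
  qed
next
  assume "\<exists>T A B C D. ?Q T A B C D"
  then obtain T A B C D where Q: "?Q T A B C D"
    by (elim exE)
  then have T: "T \<subseteq> S" "card T = 4" "T = {A, B, C, D}"
    by (auto simp only:)
  have "\<exists>E\<in>{{{A, B}, {A, C}}, {{A, B}, {A, C}, {B, D}}, {{A, B}, {A, C}, {B, D}, {C, D}}}.
      compatibility_graph T = ({A, B, C, D}, E)"
    using conjunct2[OF conjunct2[OF conjunct2[OF Q]]] by (simp only: bex_simps simp_thms)
  then obtain E where graph: "compatibility_graph T = ({A, B, C, D}, E)"
    and E: "E \<in> {{{A, B}, {A, C}}, {{A, B}, {A, C}, {B, D}}, {{A, B}, {A, C}, {B, D}, {C, D}}}"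
    by (elim bexE)
  have "card (set [A, B, C, D]) = length [A, B, C, D]"
    unfolding list.set list.size T(3)[symmetric] T(2) by simp
  then have "distinct [A, B, C, D]"
    by (rule card_distinct)
  then have neq: "A \<noteq> B" "A \<noteq> C" "A \<noteq> D" "B \<noteq> C" "B \<noteq> D" "C \<noteq> D"
    by simp_all
  \<comment> \<open>All three graphs share these two edges and two non-edges, which is the pattern
    of \<open>contextual_if_not_transitive\<close>.\<close>
  have "{A, B} \<in> E \<and> {A, C} \<in> E \<and> {A, D} \<notin> E \<and> {B, C} \<notin> E"
    using E by (elim insertE emptyE; simp add: doubleton_eq_iff neq neq[symmetric])
  moreover have mem: "A \<in> T" "B \<in> T" "C \<in> T" "D \<in> T" using T(3) by simp_all
  note iff = compatibility_graph_eq_iff[OF _ _ _ graph]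
  ultimately have "commute A B" "commute A C" "\<not> commute A D" "\<not> commute B C"
    using iff[OF mem(1,2) neq(1)] iff[OF mem(1,3) neq(2)] iff[OF mem(1,4) neq(3)]
      iff[OF mem(2,3) neq(4)] by simp_all
  moreover have "{A, B, C, D} \<subseteq> S" using T(1,3) by simp
  ultimately show "contextual S"
    using contextual_if_not_transitive assms(1) by blast
qed

end
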